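(* Let $\mathbb{H}$ be a complex Hilbert space and let $A,B\in\mathbb{B}(\mathbb{H})$ be bounded linear operators. Then \[\omega(A+B)\le 2\int_0^1 \omega\big((1-t)A+tB\big)\,dt\le \omega(A)+\omega(B).\]
   Context: $\mathbb{B}(\mathbb{H})$ denotes the $C^*$-algebra of all bounded linear operators on $\mathbb{H}$. The numerical radius of an operator $X$ on a complex Hilbert space is $\omega(X)=\sup_{\|x\|=1}|\langle Xx,x\rangle|$. *)

theory Defs
  imports "HOL-Analysis.Analysis"
begin

(* Complex Hilbert spaces of arbitrary dimension, {0} included. The norm, distance and
   topology are those of the library class banach, tied to the inner product by norm_eq_cinner.
   The inner product is linear in its first argument. *)
class complex_hilbert_space = banach +
  fixes scaleC :: "complex \<Rightarrow> 'a \<Rightarrow> 'a" (infixr "*\<^sub>C" 75)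
    and cinner :: "'a \<Rightarrow> 'a \<Rightarrow> complex"
  assumes scaleC_add_right: "a *\<^sub>C (x + y) = a *\<^sub>C x + a *\<^sub>C y"
    and scaleC_add_left: "(a + b) *\<^sub>C x = a *\<^sub>C x + b *\<^sub>C x"
    and scaleC_scaleC: "a *\<^sub>C b *\<^sub>C x = (a * b) *\<^sub>C x"
    and scaleC_one: "1 *\<^sub>C x = x"
    and scaleR_scaleC: "r *\<^sub>R x = complex_of_real r *\<^sub>C x"
    and cinner_commute: "cinner x y = cnj (cinner y x)"
    and cinner_add_left: "cinner (x + y) z = cinner x z + cinner y z"
    and cinner_scaleC_left: "cinner (a *\<^sub>C x) y = a * cinner x y"
    and cinner_self_nonneg: "0 \<le> Re (cinner x x)"
    and cinner_self_eq_zero_iff: "cinner x x = 0 \<longleftrightarrow> x = 0"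
    and norm_eq_cinner: "norm x = sqrt (Re (cinner x x))"

instantiation complex :: complex_hilbert_space
begin

definition scaleC_complex :: "complex \<Rightarrow> complex \<Rightarrow> complex" where
  "scaleC_complex a x = a * x"

definition cinner_complex :: "complex \<Rightarrow> complex \<Rightarrow> complex" where
  "cinner_complex x y = x * cnj y"

instance
  by standard
    (auto simp: scaleC_complex_def cinner_complex_def algebra_simps scaleR_conv_of_real
      cmod_def power2_eq_square)

end

(* The algebra B(H). The library type of bounded linear maps only requires real linearity. *)
definition bounded_operators :: "('a::complex_hilbert_space \<Rightarrow>\<^sub>L 'a) set" where
  "bounded_operators = {A. \<forall>c x. blinfun_apply A (c *\<^sub>C x) = c *\<^sub>C blinfun_apply A x}"

(* The supremum is taken in [0,\<infinity>): inserting 0 matters only on the space {0}, which has no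
   unit vectors and where the real Sup of the empty set is unspecified;
   see numerical_radius_eq_SUP. *)
definition numerical_radius :: "('a::complex_hilbert_space \<Rightarrow>\<^sub>L 'a) \<Rightarrow> real" where
  "numerical_radius A =
     Sup (insert 0 {cmod (cinner (blinfun_apply A x) x) | x. norm x = 1})"

lemma norm_scaleC: "norm (c *\<^sub>C x) = cmod c * norm (x::'a::complex_hilbert_space)"
proof -
  have "cinner (c *\<^sub>C x) (c *\<^sub>C x) = c * cnj c * cinner x x"
    using cinner_commute[of x "c *\<^sub>C x"] cinner_commute[of x x]
    by (simp add: cinner_scaleC_left)
  also have "\<dots> = complex_of_real ((cmod c)\<^sup>2) * cinner x x"
    by (simp only: complex_norm_square)
  finally show ?thesis
    by (simp add: norm_eq_cinner[of x] norm_eq_cinner[of "c *\<^sub>C x"] real_sqrt_mult)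
qed

lemma cmod_cinner_le: "cmod (cinner x y) \<le> norm x * norm (y::'a::complex_hilbert_space)"
proof -
  have sq: "(norm z)\<^sup>2 = Re (cinner z z)" for z :: 'a
    by (simp add: norm_eq_cinner cinner_self_nonneg)
  have add_right: "cinner z (u + v) = cinner z u + cinner z v" for z u v :: 'a
    using cinner_add_left[of u v z] cinner_commute[of z "u + v"] cinner_commute[of z u]
      cinner_commute[of z v] by simp
  have Re_le: "Re (cinner u v) \<le> norm u * norm v" for u v :: 'a
  proof -
    have "Re (cinner v u) = Re (cinner u v)"
      using arg_cong[OF cinner_commute[of v u], of Re] by simp
    then have "(norm (u + v))\<^sup>2 = (norm u)\<^sup>2 + (norm v)\<^sup>2 + 2 * Re (cinner u v)"
      by (simp add: sq cinner_add_left add_right)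
    moreover have "(norm (u + v))\<^sup>2 \<le> (norm u + norm v)\<^sup>2"
      by (intro power_mono norm_triangle_ineq norm_ge_zero)
    ultimately show ?thesis
      by (simp add: power2_sum)
  qed
  define c where "c = cnj (sgn (cinner x y))"
  have "c * cinner x y = complex_of_real (cmod (cinner x y))"
    using complex_norm_square[of "cinner x y"]
    by (cases "cinner x y = 0") (simp_all add: c_def sgn_eq field_simps power2_eq_square)
  then have "cmod (cinner x y) = Re (cinner (c *\<^sub>C x) y)"
    by (simp add: cinner_scaleC_left)
  also have "\<dots> \<le> cmod c * norm x * norm y"
    using Re_le[of "c *\<^sub>C x" y] by (simp add: norm_scaleC)
  also have "\<dots> \<le> 1 * norm x * norm y"
    by (intro mult_right_mono) (auto simp: c_def norm_sgn)
  finally show ?thesis by simp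
qed

lemma numerical_radius_eq_SUP:
  fixes A :: "'a::complex_hilbert_space \<Rightarrow>\<^sub>L 'a"
  assumes "\<exists>x::'a. x \<noteq> 0"
  shows "numerical_radius A = (SUP x\<in>{x. norm x = 1}. cmod (cinner (blinfun_apply A x) x))"
proof -
  let ?S = "{cmod (cinner (blinfun_apply A x) x) | x. norm x = 1}"
  obtain z :: 'a where "z \<noteq> 0" using assms by blast
  then have "norm (z /\<^sub>R norm z) = 1" by simp
  then obtain s where s: "s \<in> ?S" by blast
  have bdd: "bdd_above ?S"
  proof (rule bdd_aboveI)
    fix r assume "r \<in> ?S"
    then obtain x where x: "norm x = 1" "r = cmod (cinner (blinfun_apply A x) x)" by blast
    then show "r \<le> norm A"
      using cmod_cinner_le[of "blinfun_apply A x" x] norm_blinfun[of A x] by simp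
  qed
  have "0 \<le> s" using s by auto
  then have "0 \<le> Sup ?S" using cSup_upper[OF s bdd] by linarith
  then have "numerical_radius A = Sup ?S"
    using s bdd unfolding numerical_radius_def
    by (subst cSup_insert_If) (auto simp: sup_real_def max_def)
  also have "?S = (\<lambda>x. cmod (cinner (blinfun_apply A x) x)) ` {x. norm x = 1}" by blast
  finally show ?thesis .
qed

end

(* The numerical radius is a seminorm dominated by the operator norm, so
   f(t) = numerical_radius ((1 - t) A + t B) is continuous and convex. Since
   A + B is the sum of the operators at t and at 1 - t, the first bound follows by integrating
   numerical_radius (A + B) \<le> f(t) + f(1 - t), and the second by integrating
   f(t) \<le> (1 - t) f(0) + t f(1). *)
theory Submission
  imports Defs
begin

lemma cinner_scaleR_left: "cinner (r *\<^sub>R x) y = of_real r * cinner x y"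
  by (simp add: scaleR_scaleC cinner_scaleC_left)

text \<open>By Cauchy-Schwarz, \<open>norm A\<close> bounds every element, so the \<open>Sup\<close>
  in \<open>numerical_radius\<close> is a genuine least upper bound.\<close>

lemma bdd_above_numerical_range:
  fixes A :: "'a::complex_hilbert_space \<Rightarrow>\<^sub>L 'a"
  shows "bdd_above (insert 0 {cmod (cinner (blinfun_apply A x) x) | x. norm x = 1})"
proof -
  have "cmod (cinner (blinfun_apply A x) x) \<le> norm A" if "norm x = 1" for x
    using cmod_cinner_le[of "blinfun_apply A x" x] norm_blinfun[of A x] that by simp
  then show ?thesis
    by (intro bdd_aboveI[of _ "norm A"]) auto
qed

lemma cmod_cinner_le_numerical_radius:
  fixes A :: "'a::complex_hilbert_space \<Rightarrow>\<^sub>L 'a"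
  assumes "norm x = 1"
  shows "cmod (cinner (blinfun_apply A x) x) \<le> numerical_radius A"
  unfolding numerical_radius_def
  using assms by (intro cSup_upper bdd_above_numerical_range) auto

lemma numerical_radius_nonneg:
  fixes A :: "'a::complex_hilbert_space \<Rightarrow>\<^sub>L 'a"
  shows "0 \<le> numerical_radius A"
  unfolding numerical_radius_def
  by (intro cSup_upper bdd_above_numerical_range) auto

text \<open>The premise \<open>0 \<le> c\<close> covers the element 0 inserted into the set; each
  upper bound below is obtained through this rule.\<close>

lemma numerical_radius_least:
  fixes A :: "'a::complex_hilbert_space \<Rightarrow>\<^sub>L 'a"
  assumes "0 \<le> c" and "\<And>x. norm x = 1 \<Longrightarrow> cmod (cinner (blinfun_apply A x) x) \<le> c"
  shows "numerical_radius A \<le> c"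
  unfolding numerical_radius_def using assms by (intro cSup_least) auto

lemma numerical_radius_le_norm:
  fixes A :: "'a::complex_hilbert_space \<Rightarrow>\<^sub>L 'a"
  shows "numerical_radius A \<le> norm A"
proof (rule numerical_radius_least)
  fix x :: 'a
  assume "norm x = 1"
  then show "cmod (cinner (blinfun_apply A x) x) \<le> norm A"
    using cmod_cinner_le[of "blinfun_apply A x" x] norm_blinfun[of A x] by simp
qed simp

lemma numerical_radius_add_le:
  fixes A B :: "'a::complex_hilbert_space \<Rightarrow>\<^sub>L 'a"
  shows "numerical_radius (A + B) \<le> numerical_radius A + numerical_radius B"
proof (rule numerical_radius_least)
  fix x :: 'a
  assume "norm x = 1"
  then show "cmod (cinner (blinfun_apply (A + B) x) x) \<le> numerical_radius A + numerical_radius B"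
    by (auto simp: blinfun.add_left cinner_add_left
        intro!: norm_triangle_le add_mono cmod_cinner_le_numerical_radius)
qed (simp add: numerical_radius_nonneg)

lemma numerical_radius_scaleR_le:
  fixes A :: "'a::complex_hilbert_space \<Rightarrow>\<^sub>L 'a"
  shows "numerical_radius (r *\<^sub>R A) \<le> \<bar>r\<bar> * numerical_radius A"
proof (rule numerical_radius_least)
  fix x :: 'a
  assume "norm x = 1"
  then show "cmod (cinner (blinfun_apply (r *\<^sub>R A) x) x) \<le> \<bar>r\<bar> * numerical_radius A"
    by (auto simp: blinfun.scaleR_left cinner_scaleR_left norm_mult
        intro!: mult_left_mono cmod_cinner_le_numerical_radius)
qed (simp add: numerical_radius_nonneg)

text \<open>Splitting X = Y + (X - Y) and applying subadditivity leaves the numerical radius of X -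
  Y, which the operator norm dominates. Exchanging X and Y gives the absolute value.\<close>

lemma lipschitz_on_numerical_radius:
  "1-lipschitz_on S (numerical_radius :: ('a::complex_hilbert_space \<Rightarrow>\<^sub>L 'a) \<Rightarrow> real)"
proof (rule lipschitz_onI)
  fix A B :: "'a \<Rightarrow>\<^sub>L 'a"
  have "numerical_radius X \<le> numerical_radius Y + dist X Y" for X Y :: "'a \<Rightarrow>\<^sub>L 'a"
    using numerical_radius_add_le[of Y "X - Y"] numerical_radius_le_norm[of "X - Y"]
    by (simp add: dist_norm)
  from this[of A B] this[of B A]
  show "dist (numerical_radius A) (numerical_radius B) \<le> 1 * dist A B"
    by (simp add: dist_real_def dist_commute abs_le_iff)
qed simp

text \<open>Substitution by t \<mapsto> 1 - t, which maps the unit interval onto itself with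
  Jacobian of absolute value 1.\<close>

lemma has_integral_reflect_01:
  fixes f :: "real \<Rightarrow> 'b::real_normed_vector"
  assumes "(f has_integral i) {0..1}"
  shows "((\<lambda>t. f (1 - t)) has_integral i) {0..1}"
  using has_integral_affinity[of f i 0 1 "-1" 1] assms by simp

theorem theorem2p1:
  fixes A B :: "'a::complex_hilbert_space \<Rightarrow>\<^sub>L 'a"
  assumes "A \<in> bounded_operators" and "B \<in> bounded_operators"
  shows "(\<lambda>t. numerical_radius ((1 - t) *\<^sub>R A + t *\<^sub>R B)) integrable_on {0..1}
    \<and> numerical_radius (A + B)
           \<le> 2 * integral {0..1} (\<lambda>t. numerical_radius ((1 - t) *\<^sub>R A + t *\<^sub>R B))
    \<and> 2 * integral {0..1} (\<lambda>t. numerical_radius ((1 - t) *\<^sub>R A + t *\<^sub>R B))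
           \<le> numerical_radius A + numerical_radius B"
proof -
  define f where "f = (\<lambda>t. numerical_radius ((1 - t) *\<^sub>R A + t *\<^sub>R B))"
  have "continuous_on {0..1} f"
    unfolding f_def
    \<comment> \<open>The integrand is the Lipschitz numerical radius composed with a continuous
      path of operators.\<close>
    by (rule continuous_on_compose2[OF lipschitz_on_continuous_on[OF lipschitz_on_numerical_radius]])
      (auto intro!: continuous_intros)
  then have int: "f integrable_on {0..1}"
    by (rule integrable_continuous_real)
  then have f: "(f has_integral integral {0..1} f) {0..1}"
    by (rule integrable_integral)

  have "numerical_radius (A + B) \<le> f t + f (1 - t)" for t
  proof -
    have "A + B = ((1 - t) *\<^sub>R A + t *\<^sub>R B) + ((1 - (1 - t)) *\<^sub>R A + (1 - t) *\<^sub>R B)"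
      by (simp add: algebra_simps)
    then show ?thesis
      unfolding f_def by (metis numerical_radius_add_le)
  qed
  then have lower: "numerical_radius (A + B) \<le> integral {0..1} f + integral {0..1} f"
    \<comment> \<open>The interval has length 1, so the constant integrates to itself; f and its
      reflection have equal integrals, whence the factor 2.\<close>
    using has_integral_le[OF has_integral_const_real[of "numerical_radius (A + B)" 0 1]
        has_integral_add[OF f has_integral_reflect_01[OF f]]]
    by simp

  \<comment> \<open>On the unit interval both weights are nonnegative, so the absolute values from
    scaling disappear.\<close>
  have "f t \<le> (1 - t) * numerical_radius A + t * numerical_radius B" if "t \<in> {0..1}" for t
    using numerical_radius_add_le[of "(1 - t) *\<^sub>R A" "t *\<^sub>R B"]
      numerical_radius_scaleR_le[of "1 - t" A] numerical_radius_scaleR_le[of t B] that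
    by (simp add: f_def)
  moreover have t: "((\<lambda>t. t) has_integral 1 / 2) {0..1::real}"
    using ident_has_integral[of 0 "1::real"] by simp
  \<comment> \<open>The weight 1 - t is the reflection of t, so both weights integrate to 1/2;
    doubling the bound then gives the sum of the two radii.\<close>
  ultimately have upper:
      "integral {0..1} f \<le> 1 / 2 * numerical_radius A + 1 / 2 * numerical_radius B"
    by (intro has_integral_le[OF f has_integral_add[OF
          has_integral_mult_left[OF has_integral_reflect_01[OF t]] has_integral_mult_left[OF t]]])
  show ?thesis
    using int lower upper unfolding f_def by simp
qed

end
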